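(* For all integers $M\ge n\ge 2$ and every $t\in\mathbb Z$, the new-entry probability $\mu_{n,M}=\mathbb P(W_{t-1}\notin A_{n,M},\ W_t\in A_{n,M})$ satisfies $$\mu_{n,M}=\frac{(n-1)\,(n-1)!\,S(M-1,n-1)}{n^M}.$$ Equivalently, $$\mu_{n,M}=\left(1-\frac1n\right)^M\frac{(n-1)!\,S(M-1,n-1)}{(n-1)^{M-1}}.$$
   Context: $[n]=\{1,\dots,n\}$. $(X_t)_{t\in\mathbb Z}$ are iid uniform random variables on $[n]$. For $M\ge n$, $W_t=(X_{t-M+1},\dots,X_t)\in[n]^M$ is the length-$M$ sliding window at time $t$. $A_{n,M}\subset[n]^M$ is the set of onto words, i.e. words of length $M$ in which every symbol of $[n]$ appears. The probability $\mathbb P(W_{t-1}\notin A_{n,M},\,W_t\in A_{n,M})$ does not depend on $t$ by stationarity. $S(\cdot,\cdot)$ denotes a Stirling number of the second kind. *)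

theory Defs
  imports "HOL-Probability.Probability" "HOL-Combinatorics.Stirling"
begin

(* indep_vars includes measurability into count_space {1..n}, so every X t maps
   space P into {1..n}. *)
definition iid_uniform :: "'w measure \<Rightarrow> nat \<Rightarrow> (int \<Rightarrow> 'w \<Rightarrow> nat) \<Rightarrow> bool" where
  "iid_uniform P n X \<longleftrightarrow>
     prob_space P \<and>
     prob_space.indep_vars P (\<lambda>_. count_space {1..n}) X UNIV \<and>
     (\<forall>t. distr P (count_space {1..n}) (X t) = uniform_count_measure {1..n})"

definition window :: "(int \<Rightarrow> 'w \<Rightarrow> nat) \<Rightarrow> nat \<Rightarrow> int \<Rightarrow> 'w \<Rightarrow> nat list" where
  "window X M t \<omega> = map (\<lambda>s. X s \<omega>) [t - int M + 1..t]"

definition onto_words :: "nat \<Rightarrow> nat \<Rightarrow> nat list set" where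
  "onto_words n M = {w. length w = M \<and> set w = {1..n}}"

definition new_entry_prob ::
  "'w measure \<Rightarrow> (int \<Rightarrow> 'w \<Rightarrow> nat) \<Rightarrow> nat \<Rightarrow> nat \<Rightarrow> int \<Rightarrow> real" where
  "new_entry_prob P X n M t =
     measure P {\<omega> \<in> space P. window X M (t - 1) \<omega> \<notin> onto_words n M \<and>
                              window X M t \<omega> \<in> onto_words n M}"

end

theory Submission
  imports Defs
begin

text \<open>
  Write the \<open>M + 1\<close> letters involved as \<open>x # v @ [y]\<close>. Then \<open>v @ [y]\<close> is onto while
  \<open>x # v\<close> is not iff \<open>set v = {1..n} - {y}\<close> and \<open>x \<noteq> y\<close>. There are \<open>n\<close> choices for \<open>y\<close>,
  \<open>n - 1\<close> for \<open>x\<close> and \<open>(n - 1)! S(M - 1, n - 1)\<close> for \<open>v\<close>, and all words of length \<open>M + 1\<close>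
  are equally likely.
\<close>

text \<open>Induction on the length by removing the first letter \<open>a\<close>: the tail uses
  either all of \<open>A\<close> or exactly \<open>A - {a}\<close>. Multiplied by
  \<open>fact (Suc k)\<close>, the recurrence S(m+1,k+1) = (k+1) S(m,k+1) + S(m,k) has the same
  shape. \<open>A\<close> stays arbitrary because the hypothesis is also applied to
  \<open>A - {a}\<close>.\<close>

lemma card_words_onto:
  assumes "finite A"
  shows "card {v. length v = m \<and> set v = A} = fact (card A) * Stirling m (card A)"
  using assms
proof (induction m arbitrary: A)
  case 0
  have "{v. length v = 0 \<and> set v = A} = (if A = {} then {[]} else {})"
    by auto
  moreover have "Stirling 0 (card A) = 0" if "A \<noteq> {}"
    using that 0 by (intro Stirling_less) (simp add: card_gt_0_iff)
  ultimately show ?case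
    by (simp only:) simp
next
  case (Suc m)
  have fin: "finite {v. length v = m \<and> set v = B}" if "B \<subseteq> A" for B
    by (rule finite_subset[OF _ finite_lists_length_eq[of A m]]) (use that Suc.prems in auto)
  show ?case
  proof (cases "card A")
    case 0
    with Suc.prems have "{v. length v = Suc m \<and> set v = A} = {}"
      by auto
    with 0 show ?thesis by (simp only: card.empty) simp
  next
    case (Suc k)
    let ?W = "\<lambda>B. {v. length v = m \<and> set v = B}"
    have eq: "{v. length v = Suc m \<and> set v = A} =
        (\<lambda>(a, v). a # v) ` (SIGMA a:A. ?W A \<union> ?W (A - {a}))" (is "?L = ?R")
    proof
      show "?L \<subseteq> ?R"
      proof
        fix w assume w: "w \<in> ?L"
        then obtain a v where "w = a # v" "length v = m"
          by (cases w) auto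
        with w have "(a, v) \<in> (SIGMA a:A. ?W A \<union> ?W (A - {a}))"
          by auto
        with \<open>w = a # v\<close> show "w \<in> ?R" by force
      qed
    next
      show "?R \<subseteq> ?L"
      proof
        fix w assume "w \<in> ?R"
        then obtain a v where w: "w = a # v" "a \<in> A" "v \<in> ?W A \<union> ?W (A - {a})"
          by (elim imageE SigmaE) simp
        then have "length v = m" "insert a (set v) = A"
          by (elim UnE; simp add: insert_absorb)+
        with w show "w \<in> ?L" by simp
      qed
    qed
    have "card ?L = card (SIGMA a:A. ?W A \<union> ?W (A - {a}))"
      unfolding eq by (rule card_image) (auto simp: inj_on_def)
    also have "\<dots> = (\<Sum>a\<in>A. card (?W A \<union> ?W (A - {a})))"
      by (rule card_SigmaI) (use fin Suc.prems in auto)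
    also have "\<dots> = (\<Sum>a\<in>A. fact (Suc k) * Stirling m (Suc k) + fact k * Stirling m k)"
    proof (rule sum.cong[OF refl])
      fix a assume a: "a \<in> A"
      \<comment> \<open>The two kinds of tail are disjoint: \<open>a\<close> occurs in the first
        kind and not in the second.\<close>
      then have "card (?W A \<union> ?W (A - {a})) = card (?W A) + card (?W (A - {a}))"
        by (intro card_Un_disjoint fin) auto
      with a show "card (?W A \<union> ?W (A - {a})) =
          fact (Suc k) * Stirling m (Suc k) + fact k * Stirling m k"
        using Suc.IH[of A] Suc.IH[of "A - {a}"] Suc.prems \<open>card A = Suc k\<close> by simp
    qed
    \<comment> \<open>The k+1 summands are equal, and (k+1) k! = (k+1)! makes the Stirling
      recurrence appear.\<close>
    also have "\<dots> = fact (card A) * Stirling (Suc m) (card A)"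
      by (simp add: Suc algebra_simps)
    finally show ?thesis .
  qed
qed

text \<open>Prescribing the window prescribes each of its \<open>M\<close> letters; these are
  independent events of probability 1/n.\<close>

lemma prob_window_eq:
  assumes iid: "iid_uniform P n X"
    and w: "length w = M" "set w \<subseteq> {1..n}"
  shows "{\<omega> \<in> space P. window X M t \<omega> = w} \<in> sets P"
    and "measure P {\<omega> \<in> space P. window X M t \<omega> = w} = 1 / real n ^ M"
proof -
  interpret prob_space P
    using iid by (simp add: iid_uniform_def)
  have ind: "indep_vars (\<lambda>_. count_space {1..n}) X UNIV"
    and distr: "\<And>s. distr P (count_space {1..n}) (X s) = uniform_count_measure {1..n}"
    using iid by (auto simp: iid_uniform_def)
  have rv: "X s \<in> measurable P (count_space {1..n})" for s
    using ind by (auto simp: indep_vars_def)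
  \<comment> \<open>Position k of the word is read at time \<open>a + k\<close>. The singletons
    \<open>A i\<close> put the event in the product form that independence speaks about.\<close>
  define a where "a = t - int M + 1"
  define J where "J = {a..t}"
  define A where "A i = {w ! nat (i - a)}" for i
  have A: "A i \<subseteq> {1..n}" if "i \<in> J" for i
  proof -
    have "w ! nat (i - a) \<in> set w"
      using that w by (intro nth_mem) (auto simp: J_def a_def)
    with w show ?thesis by (auto simp: A_def)
  qed
  have event: "window X M t \<omega> = w \<longleftrightarrow> (\<forall>i\<in>J. X i \<omega> \<in> A i)" for \<omega>
  proof -
    have "window X M t \<omega> = w \<longleftrightarrow> (\<forall>k<M. X (a + int k) \<omega> = w ! k)"
      by (auto simp: window_def list_eq_iff_nth_eq w a_def)
    also have "\<dots> \<longleftrightarrow> (\<forall>i\<in>J. X i \<omega> \<in> A i)"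
    proof safe
      fix i assume h: "\<forall>k<M. X (a + int k) \<omega> = w ! k" "i \<in> J"
      then have "nat (i - a) < M" "a + int (nat (i - a)) = i"
        by (auto simp: J_def a_def)
      with h show "X i \<omega> \<in> A i" by (metis A_def singletonI)
    next
      fix k assume h: "\<forall>i\<in>J. X i \<omega> \<in> A i" "k < M"
      then have "a + int k \<in> J" by (auto simp: J_def a_def)
      with h show "X (a + int k) \<omega> = w ! k" by (auto simp: A_def)
    qed
    finally show ?thesis .
  qed
  have letter: "prob (X i -` A i \<inter> space P) = 1 / real n" if "i \<in> J" for i
  proof -
    have "prob (X i -` A i \<inter> space P) = measure (uniform_count_measure {1..n}) (A i)"
      using A[OF that] unfolding distr[of i, symmetric] by (subst measure_distr[OF rv]) auto
    also have "\<dots> = 1 / real n"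
      using A[OF that] by (subst measure_uniform_count_measure) (auto simp: A_def)
    finally show ?thesis .
  qed
  have "{\<omega> \<in> space P. window X M t \<omega> = w} \<in> sets P \<and>
    prob {\<omega> \<in> space P. window X M t \<omega> = w} = 1 / real n ^ M"
  \<comment> \<open>An empty window has to be treated apart: independence is stated for nonempty
    index sets, and an intersection over an empty \<open>J\<close> would be \<open>UNIV\<close>
    instead of \<open>space P\<close>.\<close>
  proof (cases "M = 0")
    case True
    with w show ?thesis by (simp add: window_def prob_space)
  next
    case False
    then have J: "J \<noteq> {}" "finite J" "card J = M"
      by (auto simp: J_def a_def)
    have eq: "{\<omega> \<in> space P. window X M t \<omega> = w} = (\<Inter>i\<in>J. X i -` A i \<inter> space P)"
      using J by (auto simp: event)
    have "(\<Inter>i\<in>J. X i -` A i \<inter> space P) \<in> sets P"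
      using J A rv by (intro sets.finite_INT) (auto intro!: measurable_sets)
    moreover have "prob (\<Inter>i\<in>J. X i -` A i \<inter> space P) = (\<Prod>i\<in>J. prob (X i -` A i \<inter> space P))"
      using J A by (intro indep_varsD[OF ind]) auto
    ultimately show ?thesis
      using J letter by (simp add: eq power_one_over)
  qed
  then show "{\<omega> \<in> space P. window X M t \<omega> = w} \<in> sets P"
    "measure P {\<omega> \<in> space P. window X M t \<omega> = w} = 1 / real n ^ M"
    by auto
qed

text \<open>The event is a finite disjoint union of the equally likely events of
  \<open>prob_window_eq\<close>. From here on, probabilities of window events are counts.\<close>

lemma prob_window_in:
  assumes iid: "iid_uniform P n X"
    and B: "B \<subseteq> {w. set w \<subseteq> {1..n} \<and> length w = M}"
  shows "measure P {\<omega> \<in> space P. window X M t \<omega> \<in> B} = real (card B) / real n ^ M"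
proof -
  interpret prob_space P
    using iid by (simp add: iid_uniform_def)
  have fin: "finite B"
    by (rule finite_subset[OF B]) (simp add: finite_lists_length_eq)
  let ?E = "\<lambda>w. {\<omega> \<in> space P. window X M t \<omega> = w}"
  have "{\<omega> \<in> space P. window X M t \<omega> \<in> B} = (\<Union>w\<in>B. ?E w)"
    by auto
  also have "prob \<dots> = (\<Sum>w\<in>B. prob (?E w))"
    by (rule finite_measure_finite_Union[OF fin])
      (use prob_window_eq(1)[OF iid] B in \<open>auto simp: disjoint_family_on_def\<close>)
  also have "\<dots> = (\<Sum>w\<in>B. 1 / real n ^ M)"
    by (rule sum.cong[OF refl]) (use prob_window_eq(2)[OF iid] B in auto)
  finally show ?thesis by simp
qed

text \<open>Measurability into \<open>count_space {1..n}\<close> bounds every letter at every point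
  of \<open>space P\<close>, so no exceptional null set has to be carried along.\<close>

lemma window_in_range:
  assumes "iid_uniform P n X" "\<omega> \<in> space P"
  shows "set (window X M t \<omega>) \<subseteq> {1..n}"
proof -
  interpret prob_space P
    using assms by (simp add: iid_uniform_def)
  have "X s \<in> measurable P (count_space {1..n})" for s
    using assms by (auto simp: iid_uniform_def indep_vars_def)
  from measurable_space[OF this assms(2)] show ?thesis
    by (auto simp: window_def)
qed

text \<open>In \<open>x # v @ [y]\<close>, \<open>x\<close> is the letter that leaves,
  \<open>y\<close> the one that enters and \<open>v\<close> the common part of the two windows. The
  triple starts with \<open>y\<close> because the ranges of \<open>x\<close> and \<open>v\<close>
  depend on it.\<close>

definition entry_words :: "nat \<Rightarrow> nat \<Rightarrow> nat list set" where
  "entry_words n m = (\<lambda>(y, x, v). x # v @ [y]) `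
     (SIGMA y:{1..n}. ({1..n} - {y}) \<times> {v. length v = m \<and> set v = {1..n} - {y}})"

lemma card_entry_words:
  assumes "n \<ge> 1"
  shows "card (entry_words n m) = n * ((n - 1) * (fact (n - 1) * Stirling m (n - 1)))"
proof -
  let ?V = "\<lambda>y. {v. length v = m \<and> set v = {1..n} - {y}}"
  have fin: "finite (?V y)" for y
    by (rule finite_subset[OF _ finite_lists_length_eq[of "{1..n}" m]]) auto
  have "card (entry_words n m) = card (SIGMA y:{1..n}. ({1..n} - {y}) \<times> ?V y)"
    unfolding entry_words_def by (rule card_image) (auto simp: inj_on_def)
  also have "\<dots> = (\<Sum>y\<in>{1..n}. card (({1..n} - {y}) \<times> ?V y))"
    by (rule card_SigmaI) (use fin in auto)
  also have "\<dots> = (\<Sum>y\<in>{1..n}. (n - 1) * (fact (n - 1) * Stirling m (n - 1)))"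
    by (rule sum.cong[OF refl]) (simp add: card_cartesian_product card_words_onto)
  finally show ?thesis by simp
qed

lemma mem_entry_words:
  "x # v @ [y] \<in> entry_words n m \<longleftrightarrow>
    y \<in> {1..n} \<and> x \<in> {1..n} - {y} \<and> length v = m \<and> set v = {1..n} - {y}"
  unfolding entry_words_def image_iff split_paired_Ex Bex_def mem_Sigma_iff
  by (simp only: append1_eq_conv list.inject prod.case mem_Collect_eq) iprover

lemma entry_words_subset:
  "entry_words n m \<subseteq> {w. set w \<subseteq> {1..n} \<and> length w = Suc (Suc m)}"
proof
  fix w assume "w \<in> entry_words n m"
  then obtain x v y where w: "w = x # v @ [y]"
    unfolding entry_words_def by (elim imageE SigmaE) simp
  with \<open>w \<in> entry_words n m\<close>
  have "y \<in> {1..n}" "x \<in> {1..n}" "length v = m" "set v \<subseteq> {1..n}"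
    unfolding w mem_entry_words by blast+
  then show "w \<in> {w. set w \<subseteq> {1..n} \<and> length w = Suc (Suc m)}"
    by (simp add: w)
qed

text \<open>Used with \<open>V = set v\<close>. If \<open>y\<close> were in \<open>V\<close>, then
  \<open>insert y V = A\<close> would force \<open>V = A\<close>, and adding \<open>x\<close> would
  give \<open>A\<close> again. So \<open>V\<close> misses exactly \<open>y\<close>, and
  \<open>x\<close> fails to fill the gap iff it differs from \<open>y\<close>.\<close>

lemma insert_eq_remove_iff:
  assumes "x \<in> A" "y \<in> A"
  shows "insert x V \<noteq> A \<and> insert y V = A \<longleftrightarrow> x \<noteq> y \<and> V = A - {y}"
  using assms by (cases "y \<in> V") (auto simp: insert_absorb)

lemma entry_words_iff:
  assumes "x \<in> {1..n}" "y \<in> {1..n}" "length v = m"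
  shows "x # v @ [y] \<in> entry_words n m \<longleftrightarrow>
    x # v \<notin> onto_words n (Suc m) \<and> v @ [y] \<in> onto_words n (Suc m)"
proof -
  have "x # v @ [y] \<in> entry_words n m \<longleftrightarrow> x \<noteq> y \<and> set v = {1..n} - {y}"
    unfolding mem_entry_words using assms by blast
  also have "\<dots> \<longleftrightarrow> insert x (set v) \<noteq> {1..n} \<and> insert y (set v) = {1..n}"
    by (rule insert_eq_remove_iff[OF assms(1,2), symmetric])
  finally show ?thesis
    using assms(3) by (simp add: onto_words_def)
qed

text \<open>Both consecutive windows of length m+1 lie inside the single window of length m+2 ending
  at \<open>t\<close>, so the joint event is a condition on one uniform word.\<close>

lemma new_entry_prob_entry_words:
  assumes "iid_uniform P n X"
  shows "new_entry_prob P X n (Suc m) t =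
    real (card (entry_words n m)) / real n ^ Suc (Suc m)"
proof -
  have iff: "window X (Suc m) (t - 1) \<omega> \<notin> onto_words n (Suc m) \<and>
      window X (Suc m) t \<omega> \<in> onto_words n (Suc m) \<longleftrightarrow>
      window X (Suc (Suc m)) t \<omega> \<in> entry_words n m" if "\<omega> \<in> space P" for \<omega>
  proof -
    \<comment> \<open>The old window covers the times t-m-1 to t-1 and the new one t-m to t; they
      overlap in the m times read by \<open>v\<close>.\<close>
    define x where "x = X (t - (1 + int m)) \<omega>"
    define y where "y = X t \<omega>"
    define v where "v = map (\<lambda>s. X s \<omega>) [t - int m..t - 1]"
    have split: "window X (Suc m) (t - 1) \<omega> = x # v" "window X (Suc m) t \<omega> = v @ [y]"
      "window X (Suc (Suc m)) t \<omega> = x # v @ [y]"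
      by (auto simp: window_def x_def y_def v_def upto_rec1[of "t - (1 + int m)"]
          upto_rec2[of "t - int m" t] algebra_simps)
    have "set (x # v @ [y]) \<subseteq> {1..n}"
      using window_in_range[OF assms that, of "Suc (Suc m)" t] by (simp only: split)
    moreover have "length v = m" by (simp add: v_def)
    ultimately show ?thesis
      unfolding split by (subst entry_words_iff) auto
  qed
  have "new_entry_prob P X n (Suc m) t =
      measure P {\<omega> \<in> space P. window X (Suc (Suc m)) t \<omega> \<in> entry_words n m}"
    unfolding new_entry_prob_def using iff by metis
  also have "\<dots> = real (card (entry_words n m)) / real n ^ Suc (Suc m)"
    by (rule prob_window_in[OF assms entry_words_subset])
  finally show ?thesis .
qed

theorem theorem3p1:
  fixes P :: "'w measure" and X :: "int \<Rightarrow> 'w \<Rightarrow> nat" and n M :: nat and t :: int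
  assumes "2 \<le> n" and "n \<le> M" and "iid_uniform P n X"
  shows "new_entry_prob P X n M t =
           real (n - 1) * fact (n - 1) * real (Stirling (M - 1) (n - 1)) / real n ^ M \<and>
         new_entry_prob P X n M t =
           (1 - 1 / real n) ^ M *
           (fact (n - 1) * real (Stirling (M - 1) (n - 1)) / real (n - 1) ^ (M - 1))"
proof -
  obtain m where M: "M = Suc m"
    using assms by (cases M) auto
  \<comment> \<open>The factor n from the choice of the entering letter cancels one power of n in
    the denominator n^(M+1).\<close>
  have 1: "new_entry_prob P X n M t =
      real (n - 1) * fact (n - 1) * real (Stirling (M - 1) (n - 1)) / real n ^ M"
    using assms(1) new_entry_prob_entry_words[OF assms(3), of m t]
    by (simp add: M card_entry_words)
  have "1 - 1 / real n = real (n - 1) / real n"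
    using assms(1) by (simp add: field_simps of_nat_diff)
  \<comment> \<open>Since n - 1 is nonzero, (n-1)^M / (n-1)^(M-1) leaves the single factor n -
    1.\<close>
  then have "(1 - 1 / real n) ^ M *
      (fact (n - 1) * real (Stirling (M - 1) (n - 1)) / real (n - 1) ^ (M - 1)) =
      real (n - 1) * fact (n - 1) * real (Stirling (M - 1) (n - 1)) / real n ^ M"
    using assms(1) by (simp add: M power_divide)
  with 1 show ?thesis by simp
qed

end
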